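(* Let $r\ge0$ be a real number, $l=\{a_i;\ i=1,2,3,\dots\}$ a sequence of real numbers, and $a\in\mathbb{R}$. If $a=\mathrm{stat}\text{-}r\text{-}\lim l$ and there is a number $m$ such that $|a_i|<m$ for all $i=1,2,\dots$, then $0=[2pr]^{1/2}\text{-}\lim\sigma(l)$, where $p=\max\{m^2+|a|^2,\ m+|a|\}$.
   Context: $\mathbb{N}=\{1,2,3,\dots\}$. For $K\subseteq\mathbb{N}$ put $K_n=\{k\in K: k\le n\}$; the asymptotic density of $K$ is $d(K)=\lim_{n\to\infty}\frac1n|K_n|$ whenever the limit exists. For a real $r\ge0$: $a=\mathrm{stat}\text{-}r\text{-}\lim l$ means that for every $\varepsilon>0$ the set $\{i\in\mathbb{N}: |a_i-a|\ge r+\varepsilon\}$ has density $0$. For a real $s\ge0$, $b=s\text{-}\lim\{b_n\}$ means that for every $\varepsilon>0$ the inequality $|b_n-b|<s+\varepsilon$ holds for all sufficiently large $n$; here $s=(2pr)^{1/2}$. The partial averages are $\mu_n=\frac1n\sum_{i=1}^n a_i$, and the sequence of partial standard deviations is $\sigma(l)=\{\sigma_n;\ n=1,2,3,\dots\}$ with $\sigma_n=\left(\frac1n\sum_{i=1}^n(a_i-\mu_n)^2\right)^{1/2}$. *)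

theory Defs
  imports Complex_Main
begin

(* The natural numbers here start at 1: a real sequence is a function on nat
   whose value at index 0 is never used, and K is counted inside {1..n}. *)

definition has_density :: "nat set \<Rightarrow> real \<Rightarrow> bool" where
  "has_density K d \<longleftrightarrow> (\<lambda>n. real (card (K \<inter> {1..n})) / real n) \<longlonglongrightarrow> d"

definition stat_r_lim :: "real \<Rightarrow> (nat \<Rightarrow> real) \<Rightarrow> real \<Rightarrow> bool" where
  "stat_r_lim r a L \<longleftrightarrow> (\<forall>\<epsilon>>0. has_density {i. 1 \<le> i \<and> \<bar>a i - L\<bar> \<ge> r + \<epsilon>} 0)"

definition r_lim :: "real \<Rightarrow> (nat \<Rightarrow> real) \<Rightarrow> real \<Rightarrow> bool" where
  "r_lim s b L \<longleftrightarrow> (\<forall>\<epsilon>>0. \<forall>\<^sub>F n in sequentially. \<bar>b n - L\<bar> < s + \<epsilon>)"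

definition partial_mean :: "(nat \<Rightarrow> real) \<Rightarrow> nat \<Rightarrow> real" where
  "partial_mean a n = (1 / real n) * (\<Sum>i=1..n. a i)"

definition partial_sd :: "(nat \<Rightarrow> real) \<Rightarrow> nat \<Rightarrow> real" where
  "partial_sd a n = sqrt ((1 / real n) * (\<Sum>i=1..n. (a i - partial_mean a n)\<^sup>2))"

end

theory Submission
  imports Defs
begin

text \<open>
  The mean minimises the mean square deviation, so \<open>\<sigma>\<^sub>n\<^sup>2\<close> is at most the average of
  \<open>(a\<^sub>i - L)\<^sup>2\<close> over \<open>i \<le> n\<close>. Put \<open>B = m + \<bar>L\<bar>\<close>, so that \<open>\<bar>a\<^sub>i - L\<bar> \<le> B\<close> for all \<open>i\<close>. Outside a
  set of density zero \<open>\<bar>a\<^sub>i - L\<bar> < r + \<epsilon>\<close>; there one factor of the square is bounded by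
  \<open>r + \<epsilon>\<close> and the other one by \<open>B\<close>. On the exceptional set the square is at most \<open>B\<^sup>2\<close>, and the
  proportion of such indices tends to \<open>0\<close>. Hence the limit superior of \<open>\<sigma>\<^sub>n\<^sup>2\<close> is at most
  \<open>B r\<close> (lemma \<open>r_lim_partial_sd_if_stat_r_lim\<close>), and \<open>B r \<le> p r \<le> 2 p r\<close>.
\<close>

text \<open>
  Expanding the squares, the two sides differ by \<open>n (\<mu>\<^sub>n - c)\<^sup>2\<close>; the cross term vanishes because
  the deviations from the mean sum to zero.
\<close>

lemma sum_sq_dev_partial_mean_le:
  "(\<Sum>i=1..n. (a i - partial_mean a n)\<^sup>2) \<le> (\<Sum>i=1..n. (a i - c)\<^sup>2)"
proof -
  define \<mu> where "\<mu> = partial_mean a n"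
  have mean: "(\<Sum>i=1..n. a i) = real n * \<mu>"
    by (cases "n = 0") (simp_all add: \<mu>_def partial_mean_def)
  have "(\<Sum>i=1..n. (a i - c)\<^sup>2)
      = (\<Sum>i=1..n. (a i - \<mu>)\<^sup>2 + 2 * (\<mu> - c) * (a i - \<mu>) + (\<mu> - c)\<^sup>2)"
    by (intro sum.cong refl) (simp add: power2_eq_square algebra_simps)
  also have "\<dots> = (\<Sum>i=1..n. (a i - \<mu>)\<^sup>2) + 2 * (\<mu> - c) * (\<Sum>i=1..n. a i - \<mu>)
      + real n * (\<mu> - c)\<^sup>2"
    by (simp add: sum.distrib sum_distrib_left)
  also have "(\<Sum>i=1..n. a i - \<mu>) = 0"
    using mean by (simp add: sum_subtractf)
  finally show ?thesis
    by (simp add: \<mu>_def)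
qed

corollary partial_sd_le:
  "partial_sd a n \<le> sqrt ((1 / real n) * (\<Sum>i=1..n. (a i - c)\<^sup>2))"
  unfolding partial_sd_def
  by (intro real_sqrt_le_mono mult_left_mono sum_sq_dev_partial_mean_le) simp

lemma mean_sq_dev_le_exceptional_proportion:
  fixes B t L :: real
  assumes "n > 0" "B \<ge> 0" "t \<ge> 0"
    and bound: "\<And>i. i \<ge> 1 \<Longrightarrow> \<bar>a i - L\<bar> \<le> B"
  shows "(1 / real n) * (\<Sum>i=1..n. (a i - L)\<^sup>2)
      \<le> B * t + B\<^sup>2 * (real (card ({i. 1 \<le> i \<and> \<bar>a i - L\<bar> \<ge> t} \<inter> {1..n})) / real n)"
proof -
  define K where "K = {i. 1 \<le> i \<and> \<bar>a i - L\<bar> \<ge> t}"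
  have "(a i - L)\<^sup>2 \<le> B * t + (if i \<in> K then B\<^sup>2 else 0)" if "i \<in> {1..n}" for i
  proof (cases "i \<in> K")
    case True
    have "(a i - L)\<^sup>2 \<le> B\<^sup>2"
      using bound[of i] that by (intro abs_le_square_iff[THEN iffD1]) auto
    then show ?thesis
      using True assms by (simp add: add_increasing)
  next
    case False
    then have "\<bar>a i - L\<bar> * \<bar>a i - L\<bar> \<le> B * t"
      using bound[of i] that assms by (intro mult_mono) (auto simp: K_def)
    then show ?thesis
      using False by (simp add: power2_eq_square)
  qed
  then have "(\<Sum>i=1..n. (a i - L)\<^sup>2) \<le> (\<Sum>i=1..n. B * t + (if i \<in> K then B\<^sup>2 else 0))"
    by (rule sum_mono)
  also have "\<dots> = real n * (B * t) + B\<^sup>2 * real (card (K \<inter> {1..n}))"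
    by (simp add: sum.distrib Int_commute flip: sum.inter_restrict)
  finally show ?thesis
    using \<open>n > 0\<close> unfolding K_def[symmetric] by (simp add: field_simps)
qed

text \<open>
  Of the two factors of \<open>(a\<^sub>i - L)\<^sup>2\<close>, only one is controlled by the statistical radius, the
  other by the uniform bound; this gives the geometric mean of \<open>B\<close> and \<open>r\<close>.
\<close>

lemma r_lim_partial_sd_if_stat_r_lim:
  fixes B r L :: real
  assumes "r \<ge> 0" "B > 0"
    and lim: "stat_r_lim r a L"
    and bound: "\<And>i. i \<ge> 1 \<Longrightarrow> \<bar>a i - L\<bar> \<le> B"
  shows "r_lim (sqrt (B * r)) (partial_sd a) 0"
  unfolding r_lim_def
proof (intro allI impI)
  fix e :: real
  assume "e > 0"
  \<comment> \<open>The budget \<open>e\<^sup>2\<close> for the square is split evenly between widening the radius and the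
     exceptional indices.\<close>
  define \<epsilon> where "\<epsilon> = e\<^sup>2 / (2 * B)"
  define d where
    "d n = real (card ({i. 1 \<le> i \<and> \<bar>a i - L\<bar> \<ge> r + \<epsilon>} \<inter> {1..n})) / real n" for n
  have "\<epsilon> > 0"
    using \<open>e > 0\<close> \<open>B > 0\<close> by (simp add: \<epsilon>_def)
  then have "d \<longlonglongrightarrow> 0"
    using lim unfolding stat_r_lim_def has_density_def d_def by blast
  then have "\<forall>\<^sub>F n in sequentially. d n < e\<^sup>2 / (2 * B\<^sup>2)"
    using \<open>e > 0\<close> \<open>B > 0\<close> by (intro order_tendstoD) (auto intro!: divide_pos_pos)
  then show "\<forall>\<^sub>F n in sequentially. \<bar>partial_sd a n - 0\<bar> < sqrt (B * r) + e"
    using eventually_gt_at_top[of 0]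
  proof eventually_elim
    case (elim n)
    have "(1 / real n) * (\<Sum>i=1..n. (a i - L)\<^sup>2) \<le> B * (r + \<epsilon>) + B\<^sup>2 * d n"
      unfolding d_def using elim assms \<open>\<epsilon> > 0\<close>
      by (intro mean_sq_dev_le_exceptional_proportion) auto
    also have "\<dots> < B * r + e\<^sup>2"
      using elim(1) \<open>B > 0\<close> by (simp add: \<epsilon>_def field_simps)
    finally have "partial_sd a n < sqrt (B * r + e\<^sup>2)"
      using partial_sd_le[of a n L] by (meson le_less_trans real_sqrt_less_mono)
    also have "\<dots> \<le> sqrt (B * r) + e"
      using sqrt_add_le_add_sqrt[of "B * r" "e\<^sup>2"] assms(1,2) \<open>e > 0\<close> by simp
    finally show ?case
      by (simp add: partial_sd_def sum_nonneg)
  qed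
qed

lemma r_lim_mono:
  assumes "r_lim s b L" "s \<le> t"
  shows "r_lim t b L"
  unfolding r_lim_def
proof (intro allI impI)
  fix e :: real
  assume "e > 0"
  then have "\<forall>\<^sub>F n in sequentially. \<bar>b n - L\<bar> < s + e"
    using assms(1) by (simp add: r_lim_def)
  then show "\<forall>\<^sub>F n in sequentially. \<bar>b n - L\<bar> < t + e"
    by eventually_elim (use assms(2) in simp)
qed

theorem theorem4p2:
  fixes r L m p :: real and a :: "nat \<Rightarrow> real"
  assumes "r \<ge> 0"
    and "stat_r_lim r a L"
    and "\<And>i. i \<ge> 1 \<Longrightarrow> \<bar>a i\<bar> < m"
    and "p = max (m\<^sup>2 + \<bar>L\<bar>\<^sup>2) (m + \<bar>L\<bar>)"
  shows "r_lim (sqrt (2 * p * r)) (partial_sd a) 0"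
proof (rule r_lim_mono)
  have "m > 0"
    using assms(3)[of 1] by simp
  have "\<bar>a i - L\<bar> \<le> m + \<bar>L\<bar>" if "i \<ge> 1" for i
    using assms(3)[OF that] by linarith
  then show "r_lim (sqrt ((m + \<bar>L\<bar>) * r)) (partial_sd a) 0"
    using assms(1,2) \<open>m > 0\<close> by (intro r_lim_partial_sd_if_stat_r_lim) auto
  have "m + \<bar>L\<bar> \<le> 2 * p"
    using assms(4) \<open>m > 0\<close> by linarith
  then show "sqrt ((m + \<bar>L\<bar>) * r) \<le> sqrt (2 * p * r)"
    using assms(1) by (intro real_sqrt_le_mono mult_right_mono)
qed

end
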